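(* Let $Q^T\tau$ be a system of $s\ge v-1$ contrasts of $v$ treatments, with $\mathrm{rank}(Q)=v-1$. Then the uniform design $\bar w=1_v/v$ is $\Psi_0$-optimal for estimating $Q^T\tau$.
   Context: A system of $s$ treatment contrasts $Q^T\tau$ is given by a real $v\times s$ matrix $Q$ with $Q^T1_v=0_s$. A design is a vector $w=(w_1,\ldots,w_v)^T$ with $w_i\in[0,1]$, $\sum_i w_i=1$; it is feasible if and only if $w_i>0$ for all $i$ (written $w>0$). $M(w)=\mathrm{diag}(w_1,\ldots,w_v)$ and $V_Q(w)=Q^TM^{-1}(w)Q$ for $w>0$. The criterion $\Psi_0$ ($D$-optimality, including its rank deficient version) is $\Psi_0(w)=\prod_{j=1}^{r}\lambda_j(V_Q(w))$, where $r=\mathrm{rank}(Q)$ and $\lambda_1\ge\lambda_2\ge\ldots$ are the ordered eigenvalues; i.e. $\Psi_0(w)$ is the product of all non-zero eigenvalues (pseudo-determinant) of $V_Q(w)$. A design is $\Psi_0$-optimal if it minimizes $\Psi_0(w)$ over all designs $w>0$. *)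

theory Defs
  imports
    "Jordan_Normal_Form.Char_Poly"
    "Jordan_Normal_Form.Gauss_Jordan_Elimination"
    "Jordan_Normal_Form.DL_Rank"
begin

definition ones_vec :: "nat \<Rightarrow> real vec" where
  "ones_vec n = vec n (\<lambda>_. 1)"

definition contrast_matrix :: "nat \<Rightarrow> nat \<Rightarrow> real mat \<Rightarrow> bool" where
  "contrast_matrix v s Q \<longleftrightarrow>
     Q \<in> carrier_mat v s \<and> transpose_mat Q *\<^sub>v ones_vec v = 0\<^sub>v s"

definition is_design :: "nat \<Rightarrow> real vec \<Rightarrow> bool" where
  "is_design v w \<longleftrightarrow>
     w \<in> carrier_vec v \<and> (\<forall>i<v. 0 \<le> w $ i \<and> w $ i \<le> 1) \<and> (\<Sum>i<v. w $ i) = 1"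

definition feasible_design :: "nat \<Rightarrow> real vec \<Rightarrow> bool" where
  "feasible_design v w \<longleftrightarrow> is_design v w \<and> (\<forall>i<v. 0 < w $ i)"

definition uniform_design :: "nat \<Rightarrow> real vec" where
  "uniform_design v = (1 / real v) \<cdot>\<^sub>v ones_vec v"

definition moment_matrix :: "real vec \<Rightarrow> real mat" where
  "moment_matrix w = mat_diag (dim_vec w) (\<lambda>i. w $ i)"

(* Meaningful only for entrywise positive w, where the moment matrix is invertible. *)
definition V_matrix :: "real mat \<Rightarrow> real vec \<Rightarrow> real mat" where
  "V_matrix Q w = transpose_mat Q * the (mat_inverse (moment_matrix w)) * Q"

(* eigval_desc A j is the j-th largest eigenvalue, j = 1, 2, ..., counted with
   algebraic multiplicity. Meant for real symmetric A, whose characteristic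
   polynomial splits over the reals; for other A nonreal eigenvalues are ignored. *)
definition eigval_desc :: "real mat \<Rightarrow> nat \<Rightarrow> real" where
  "eigval_desc A j = rev (sorted_list_of_multiset (proots (char_poly A))) ! (j - 1)"

(* vec_space.rank n A is the dimension of the column span of A inside n-space. *)
definition mat_rank :: "real mat \<Rightarrow> nat" where
  "mat_rank A = vec_space.rank (dim_row A) A"

definition Psi0 :: "real mat \<Rightarrow> real vec \<Rightarrow> real" where
  "Psi0 Q w = (\<Prod>j = 1..mat_rank Q. eigval_desc (V_matrix Q w) j)"

definition Psi0_optimal :: "nat \<Rightarrow> real mat \<Rightarrow> real vec \<Rightarrow> bool" where
  "Psi0_optimal v Q w \<longleftrightarrow>
     feasible_design v w \<and> (\<forall>u. feasible_design v u \<longrightarrow> Psi0 Q w \<le> Psi0 Q u)"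

end

theory Submission
  imports Defs
begin

text \<open>
  Put $K = Q Q^T$ and $W = \mathrm{diag}(w)$. Up to a power of $x$, the characteristic polynomial
  of $V_Q(w) = Q^T W^{-1} Q$ is that of $K W^{-1}$, which is $\det (x W - K) / \prod_i w_i$.
  Since the rows and columns of $K$ sum to zero and $\sum_i w_i = 1$, column and row additions give
  $\det (x W - K) = x\, h(x)$ where $h(0)$ is, up to sign, a cofactor of $K$ and so independent of
  $w$. As $V_Q(w)$ is positive semidefinite, its $v - 1$ largest eigenvalues are the roots of $h$;
  hence $\Psi_0(w) \prod_i w_i$ is constant, and $\prod_i w_i$ is maximal at the uniform design by
  the inequality of the arithmetic and geometric means.
\<close>

section \<open>Characteristic polynomials of A B and B A\<close>

text \<open>Sylvester's identity for rectangular factors. The block matrix \<open>?Y\<close> with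
  rows (x I, A) and (B, I) becomes block triangular on multiplication by \<open>?L\<close>, of
  determinant 1, and by \<open>?R\<close>, of determinant x^m. The two products evaluate det
  \<open>?Y\<close> once through A B and once through B A.\<close>

lemma char_poly_mult_commute:
  fixes A B :: "'a :: idom mat"
  assumes A: "A \<in> carrier_mat n m" and B: "B \<in> carrier_mat m n"
  shows "[:0, 1:] ^ m * char_poly (A * B) = [:0, 1:] ^ n * char_poly (B * A)"
proof -
  let ?x = "[:0, 1:] :: 'a poly"
  let ?C = "map_mat (\<lambda>a :: 'a. [:a:])"
  let ?Y = "four_block_mat (?x \<cdot>\<^sub>m 1\<^sub>m n) (?C A) (?C B) (1\<^sub>m m)"
  let ?L = "four_block_mat (1\<^sub>m n) (0\<^sub>m n m) (- ?C B) (1\<^sub>m m)"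
  let ?R = "four_block_mat (1\<^sub>m n) (- ?C A) (0\<^sub>m m n) (?x \<cdot>\<^sub>m 1\<^sub>m m)"
  have cA: "?C A \<in> carrier_mat n m" and cB: "?C B \<in> carrier_mat m n" using A B by auto
  have Y: "?Y \<in> carrier_mat (n + m) (n + m)" using A B by auto
  have L: "?L \<in> carrier_mat (n + m) (n + m)" using A B by auto
  have R: "?R \<in> carrier_mat (n + m) (n + m)" using A B by auto
  have CC: "?C A * (- ?C B) = - ?C (A * B)" "?C B * (- ?C A) = - ?C (B * A)"
    using cA cB by (simp_all add: map_poly_mult(1)[OF A B] map_poly_mult(1)[OF B A])
  have AB: "?x \<cdot>\<^sub>m 1\<^sub>m n + ?C A * (- ?C B) = char_poly_matrix (A * B)"
    unfolding char_poly_matrix_def CC using A B by (intro eq_matI) auto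
  have BA: "?C B * (- ?C A) + ?x \<cdot>\<^sub>m 1\<^sub>m m = char_poly_matrix (B * A)"
    unfolding char_poly_matrix_def CC using A B by (intro eq_matI) auto
  \<comment> \<open>\<open>?L\<close> clears the lower left block and leaves the Schur complement x
    I - A B.\<close>
  have YL: "?Y * ?L = four_block_mat (char_poly_matrix (A * B)) (?C A) (0\<^sub>m m n) (1\<^sub>m m)"
  proof -
    have "?Y * ?L = four_block_mat (?x \<cdot>\<^sub>m 1\<^sub>m n * 1\<^sub>m n + ?C A * (- ?C B))
      (?x \<cdot>\<^sub>m 1\<^sub>m n * 0\<^sub>m n m + ?C A * 1\<^sub>m m)
      (?C B * 1\<^sub>m n + 1\<^sub>m m * (- ?C B)) (?C B * 0\<^sub>m n m + 1\<^sub>m m * 1\<^sub>m m)"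
      using cA cB by (intro mult_four_block_mat[of _ n n _ m _ m _ _ n _ m]) auto
    moreover have "?x \<cdot>\<^sub>m 1\<^sub>m n * 1\<^sub>m n = ?x \<cdot>\<^sub>m 1\<^sub>m n" by (rule right_mult_one_mat[of _ n]) simp
    moreover have "?x \<cdot>\<^sub>m 1\<^sub>m n * 0\<^sub>m n m + ?C A * 1\<^sub>m m = ?C A" using cA by simp
    moreover have "?C B * 1\<^sub>m n + 1\<^sub>m m * (- ?C B) = 0\<^sub>m m n"
      using cB by (subst left_mult_one_mat[of _ m n]) (auto intro!: eq_matI)
    moreover have "?C B * 0\<^sub>m n m + 1\<^sub>m m * 1\<^sub>m m = 1\<^sub>m m" using cB by simp
    ultimately show ?thesis by (simp only: AB)
  qed
  \<comment> \<open>\<open>?R\<close> clears the upper right block. Its corner x I scales the last m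
    columns by x, which avoids dividing by x in the polynomial ring.\<close>
  have YR: "?Y * ?R = four_block_mat (?x \<cdot>\<^sub>m 1\<^sub>m n) (0\<^sub>m n m) (?C B) (char_poly_matrix (B * A))"
  proof -
    have "?Y * ?R = four_block_mat (?x \<cdot>\<^sub>m 1\<^sub>m n * 1\<^sub>m n + ?C A * 0\<^sub>m m n)
      (?x \<cdot>\<^sub>m 1\<^sub>m n * (- ?C A) + ?C A * (?x \<cdot>\<^sub>m 1\<^sub>m m))
      (?C B * 1\<^sub>m n + 1\<^sub>m m * 0\<^sub>m m n) (?C B * (- ?C A) + 1\<^sub>m m * (?x \<cdot>\<^sub>m 1\<^sub>m m))"
      using cA cB by (intro mult_four_block_mat[of _ n n _ m _ m _ _ n _ m]) auto
    moreover have "?x \<cdot>\<^sub>m 1\<^sub>m n * 1\<^sub>m n + ?C A * 0\<^sub>m m n = ?x \<cdot>\<^sub>m 1\<^sub>m n"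
      using cA by (subst right_mult_one_mat[of _ n]) auto
    moreover have "?x \<cdot>\<^sub>m 1\<^sub>m n * (- ?C A) + ?C A * (?x \<cdot>\<^sub>m 1\<^sub>m m) = 0\<^sub>m n m"
    proof -
      have "?x \<cdot>\<^sub>m 1\<^sub>m n * (- ?C A) = ?x \<cdot>\<^sub>m (- ?C A)"
        using cA by (subst mult_smult_assoc_mat[of _ n n _ m]) auto
      moreover have "?C A * (?x \<cdot>\<^sub>m 1\<^sub>m m) = ?x \<cdot>\<^sub>m ?C A"
        using cA by (subst mult_smult_distrib[of _ n m _ m]) auto
      ultimately show ?thesis using cA by (auto intro!: eq_matI)
    qed
    moreover have "?C B * 1\<^sub>m n + 1\<^sub>m m * 0\<^sub>m m n = ?C B" using cB by simp
    moreover have "1\<^sub>m m * (?x \<cdot>\<^sub>m 1\<^sub>m m) = ?x \<cdot>\<^sub>m 1\<^sub>m m" by (rule left_mult_one_mat[of _ m m]) simp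
    ultimately show ?thesis by (simp only: BA)
  qed
  have "det ?L = 1" using cB by (subst det_four_block_mat_upper_right_zero[of _ n _ m]) auto
  moreover have "det ?R = ?x ^ m"
    using cA by (subst det_four_block_mat_lower_left_zero[of _ n _ m]) auto
  moreover have "det (?Y * ?L) = char_poly (A * B)"
    unfolding YL char_poly_def using A B cA
    by (subst det_four_block_mat_lower_left_zero[of _ n _ m]) auto
  moreover have "det (?Y * ?R) = ?x ^ n * char_poly (B * A)"
    unfolding YR char_poly_def using A B cB
    by (subst det_four_block_mat_upper_right_zero[of _ n _ m]) auto
  ultimately show ?thesis
    using det_mult[OF Y L] det_mult[OF Y R] by (simp add: mult.commute)
qed

section \<open>Nonnegative real spectrum of Q^T D Q\<close>

text \<open>Over the complex numbers the characteristic polynomial splits. A complex eigenvalue a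
  with eigenvector z satisfies a |z|^2 = \<Sum> d_k |(Q z)_k|^2, so it is real and nonnegative, and
  the factorization descends to the reals with multiplicities kept.\<close>

lemma char_poly_psd_splits:
  fixes Q :: "real mat"
  assumes Q: "Q \<in> carrier_mat v s" and d: "\<And>k. k < v \<Longrightarrow> 0 \<le> d k"
  shows "\<exists>B. char_poly (transpose_mat Q * mat_diag v d * Q) = (\<Prod>b\<in>#B. [:- b, 1:])
    \<and> size B = s \<and> (\<forall>b\<in>#B. 0 \<le> b)"
proof -
  let ?A = "transpose_mat Q * mat_diag v d * Q"
  let ?c = "map_mat complex_of_real"
  have A: "?A \<in> carrier_mat s s" using Q by auto
  hence cA: "?c ?A \<in> carrier_mat s s" by auto
  have Aij: "?A $$ (i, j) = (\<Sum>k<v. d k * Q $$ (k, i) * Q $$ (k, j))" if "i < s" "j < s" for i j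
    using Q that
    by (subst mat_diag_mult_right[of _ s])
       (auto simp: scalar_prod_def mult.commute atLeast0LessThan intro!: sum.cong)
  have ev: "\<exists>b\<ge>0. a = complex_of_real b" if a: "eigenvalue (?c ?A) a" for a
  proof -
    from a obtain z where z: "z \<in> carrier_vec s" "z \<noteq> 0\<^sub>v s" and Az: "?c ?A *\<^sub>v z = a \<cdot>\<^sub>v z"
      using A unfolding eigenvalue_def eigenvector_def by auto
    \<comment> \<open>Here y = Q z, S = z^* z and T = y^* D y. Pairing the eigenvalue equation with
      the conjugate of z gives a S = T.\<close>
    define y where "y k = (\<Sum>j<s. of_real (Q $$ (k, j)) * z $ j)" for k
    define S where "S = (\<Sum>i<s. (cmod (z $ i))\<^sup>2)"
    define T where "T = (\<Sum>k<v. d k * (cmod (y k))\<^sup>2)"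
    have row: "a * z $ i = (\<Sum>k<v. of_real (d k * Q $$ (k, i)) * y k)" if i: "i < s" for i
    proof -
      have "a * z $ i = (?c ?A *\<^sub>v z) $ i" unfolding Az using z i by simp
      also have "\<dots> = (\<Sum>j<s. of_real (?A $$ (i, j)) * z $ j)"
        using A z i by (simp add: scalar_prod_def atLeast0LessThan del: index_mult_mat)
      also have "\<dots> = (\<Sum>j<s. \<Sum>k<v. of_real (d k * Q $$ (k, i)) * (of_real (Q $$ (k, j)) * z $ j))"
        by (rule sum.cong[OF refl]) (simp add: Aij[OF i] sum_distrib_right mult.assoc del: index_mult_mat)
      also have "\<dots> = (\<Sum>k<v. of_real (d k * Q $$ (k, i)) * y k)"
        by (subst sum.swap) (simp add: y_def sum_distrib_left)
      finally show ?thesis .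
    qed
    have "a * of_real S = (\<Sum>i<s. cnj (z $ i) * (a * z $ i))"
      unfolding S_def of_real_sum sum_distrib_left
      by (rule sum.cong[OF refl]) (simp only: complex_norm_square ac_simps)
    also have "\<dots> = (\<Sum>i<s. \<Sum>k<v. cnj (z $ i) * (of_real (d k * Q $$ (k, i)) * y k))"
      by (rule sum.cong[OF refl]) (simp add: row sum_distrib_left)
    also have "\<dots> = (\<Sum>k<v. of_real (d k) * (y k * cnj (y k)))"
      by (subst sum.swap) (auto simp: y_def cnj_sum sum_distrib_left ac_simps intro!: sum.cong)
    also have "\<dots> = of_real T"
      unfolding T_def of_real_sum
      by (rule sum.cong[OF refl]) (simp only: complex_norm_square of_real_mult)
    finally have eq: "a * of_real S = of_real T" .
    obtain i where i: "i < s" "z $ i \<noteq> 0" using z by (metis carrier_vecD eq_vecI index_zero_vec)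
    have S: "S > 0" unfolding S_def using i by (intro sum_pos2[of _ i]) auto
    have T: "T \<ge> 0" unfolding T_def using d by (auto intro!: sum_nonneg)
    have "a = of_real (T / S)" using eq S by (simp add: field_simps)
    thus ?thesis using S T by (intro exI[of _ "T / S"]) auto
  qed
  obtain as where as: "char_poly (?c ?A) = (\<Prod>a\<leftarrow>as. [:- a, 1:])" and len: "length as = s"
    using char_poly_factorized[OF cA] by auto
  have root: "\<exists>b\<ge>0. a = complex_of_real b" if "a \<in> set as" for a
  proof (rule ev)
    show "eigenvalue (?c ?A) a"
      unfolding eigenvalue_root_char_poly[OF cA] as using that
      by (auto simp: poly_prod_list prod_list_zero_iff image_iff)
  qed
  \<comment> \<open>All complex roots are real, so taking real parts loses nothing. The embedding of
    real into complex polynomials is injective, which transfers the factorization back.\<close>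
  define bs where "bs = map Re as"
  have as_bs: "as = map complex_of_real bs"
    unfolding bs_def map_map by (rule map_idI[symmetric]) (use root in force)
  have nn: "\<forall>b\<in>set bs. 0 \<le> b" unfolding bs_def using root by force
  interpret of_real_poly: map_poly_inj_comm_ring_hom complex_of_real ..
  have hom: "map_poly complex_of_real (\<Prod>b\<leftarrow>bs. [:- b, 1:]) = (\<Prod>b\<leftarrow>bs. [:- of_real b, 1:])"
    by (induction bs) (simp_all add: of_real_poly.hom_mult del: mult_pCons_left)
  have "map_poly complex_of_real (char_poly ?A) = map_poly complex_of_real (\<Prod>b\<leftarrow>bs. [:- b, 1:])"
    unfolding of_real_hom.char_poly_hom[OF A, symmetric] as as_bs
    unfolding hom by (simp add: o_def)
  hence "char_poly ?A = (\<Prod>b\<leftarrow>bs. [:- b, 1:])" by simp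
  moreover have "length bs = s" using len by (simp add: bs_def)
  ultimately show ?thesis using nn
    by (intro exI[of _ "mset bs"]) (simp add: prod_mset_prod_list flip: mset_map)
qed

section \<open>Product of the largest eigenvalues from a constant coefficient\<close>

text \<open>While a factor x remains, the product vanishes at 0, so one of its roots is 0 and can be
  cancelled. \<open>C\<close> may contain further zeros, as g may itself vanish at 0.\<close>

lemma linear_factors_split_off_zeros:
  fixes B :: "real multiset"
  assumes "(\<Prod>b\<in>#B. [:- b, 1:]) = [:0, 1:] ^ m * g"
  shows "\<exists>C. B = replicate_mset m 0 + C \<and> g = (\<Prod>b\<in>#C. [:- b, 1:])"
  using assms
proof (induction m arbitrary: B)
  case 0
  thus ?case by auto
next
  case (Suc m)
  have "poly (\<Prod>b\<in>#B. [:- b, 1:]) 0 = 0" unfolding Suc.prems by simp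
  hence "0 \<in># B" by (auto simp: poly_prod_mset image_iff)
  then obtain B' where B': "B = add_mset 0 B'" by (metis mset_add)
  have "[:0, 1:] * (\<Prod>b\<in>#B'. [:- b, 1:]) = [:0, 1:] * ([:0, 1:] ^ m * g)"
    using Suc.prems unfolding B' by (simp add: mult.assoc)
  hence "(\<Prod>b\<in>#B'. [:- b, 1:]) = [:0, 1:] ^ m * g" by (simp only: mult_cancel_left) simp
  from Suc.IH[OF this] show ?case unfolding B' by auto
qed

lemma proots_linear_factors: "proots (\<Prod>b\<in>#B. [:- b, 1:]) = (B :: 'a :: idom multiset)"
proof (induction B)
  case (add x B)
  have "(\<Prod>b\<in>#B. [:- b, 1:]) \<noteq> 0" by (auto simp: prod_mset_zero_iff)
  thus ?case using add by (simp add: proots_mult del: mult_pCons_left)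
qed simp

text \<open>No root is negative, so the m zeros split off come last in descending order and the r
  largest eigenvalues are exactly the roots of g. By Vieta their product is g(0) up to sign.\<close>

lemma prod_largest_eigvals:
  fixes A :: "real mat"
  assumes A: "char_poly A = (\<Prod>b\<in>#B. [:- b, 1:])" and nn: "\<forall>b\<in>#B. 0 \<le> b"
    and size: "size B = m + r" and fac: "char_poly A = [:0, 1:] ^ m * g"
  shows "(\<Prod>j = 1..r. eigval_desc A j) = (-1) ^ r * poly g 0"
    and "0 \<le> (\<Prod>j = 1..r. eigval_desc A j)"
proof -
  obtain C where B: "B = replicate_mset m 0 + C" and g: "g = (\<Prod>b\<in>#C. [:- b, 1:])"
    using linear_factors_split_off_zeros[of B m g] A fac by auto
  define cs where "cs = sorted_list_of_multiset C"
  have C: "mset cs = C" by (simp add: cs_def)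
  have r: "length cs = r" using size unfolding B C[symmetric] by simp
  \<comment> \<open>Nonnegativity lets the zeros stand in front of the ascending list; after
    reversal the first r positions belong to \<open>cs\<close>.\<close>
  have "sorted (replicate m 0 @ cs)"
    using nn unfolding sorted_append cs_def B by (auto simp: sorted_replicate)
  moreover have "mset (replicate m 0 @ cs) = B" unfolding B C[symmetric] by simp
  ultimately have "sorted_list_of_multiset B = replicate m 0 @ cs"
    by (metis sorted_list_of_multiset_mset sorted_sort_id)
  hence ev: "eigval_desc A j = rev cs ! (j - 1)" if "1 \<le> j" "j \<le> r" for j
    unfolding eigval_desc_def A proots_linear_factors using that r by (simp add: nth_append)
  \<comment> \<open>Eigenvalues are counted from 1, list positions from 0.\<close>
  have "(\<Prod>j = 1..r. eigval_desc A j) = (\<Prod>j<r. rev cs ! j)"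
    by (rule prod.reindex_bij_witness[of _ Suc "\<lambda>j. j - 1"]) (auto simp: ev)
  also have "\<dots> = prod_list (rev cs)" by (simp add: prod.list_conv_set_nth r atLeast0LessThan)
  also have "\<dots> = prod_mset C" unfolding C[symmetric] prod_mset_prod_list
    by (simp add: prod_list.rev)
  finally have eq: "(\<Prod>j = 1..r. eigval_desc A j) = prod_mset C" .
  have "poly g 0 = (-1) ^ size C * prod_mset C" unfolding g by (induction C) auto
  moreover have "size C = r" unfolding C[symmetric] using r by simp
  ultimately show "(\<Prod>j = 1..r. eigval_desc A j) = (-1) ^ r * poly g 0"
    unfolding eq by (simp flip: mult.assoc power_add mult_2)
  have "\<forall>b\<in>#C. 0 \<le> b" using nn B by auto
  thus "0 \<le> (\<Prod>j = 1..r. eigval_desc A j)" unfolding eq by (induction C) auto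
qed

section \<open>The determinant of x W - K for a matrix K with zero row and column sums\<close>

text \<open>The point is the order of quantifiers: c is chosen before w. It is the (0,0) cofactor of
  -K, which remains after one column addition, removal of the factor x, evaluation at 0 and one row
  addition.\<close>

lemma det_diag_minus_centered:
  fixes K :: "real mat"
  assumes K: "K \<in> carrier_mat v v" and v: "v \<ge> 1"
    and row: "\<And>i. i < v \<Longrightarrow> (\<Sum>j<v. K $$ (i, j)) = 0"
    and col: "\<And>j. j < v \<Longrightarrow> (\<Sum>i<v. K $$ (i, j)) = 0"
  shows "\<exists>c. \<forall>w. (\<Sum>i<v. w i) = 1 \<longrightarrow> (\<exists>h. poly h 0 = c \<and>
    det (mat v v (\<lambda>(i, j). (if i = j then [:0, w i:] else 0) - [:K $$ (i, j):])) = [:0, 1:] * h)"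
proof -
  let ?P = "\<lambda>w. mat v v (\<lambda>(i, j). (if i = j then [:0, w i:] else 0) - [:K $$ (i, j):])"
  \<comment> \<open>Right multiplication by \<open>?T\<close> adds all columns to column 0, and left
    multiplication by \<open>?U\<close> adds all rows to row 0. \<open>?H\<close> is the result of
    the column addition with x taken out of column 0, \<open>?D\<close> puts that x back, and
    \<open>?E\<close> is \<open>?H\<close> at x = 0.\<close>
  let ?T = "mat v v (\<lambda>(i, j). if i = j \<or> j = 0 then 1 else (0 :: real poly))"
  let ?H = "\<lambda>w. mat v v (\<lambda>(i, j). if j = 0 then [:w i:]
    else (if i = j then [:0, w i:] else 0) - [:K $$ (i, j):])"
  let ?D = "mat_diag v (\<lambda>i. if i = 0 then [:0, 1:] else (1 :: real poly))"
  let ?E = "\<lambda>w. mat v v (\<lambda>(i, j). if j = 0 then w i else - K $$ (i, j))"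
  let ?U = "mat v v (\<lambda>(i, j). if i = j \<or> i = 0 then 1 else (0 :: real))"
  let ?c = "cofactor (mat v v (\<lambda>(i, j). - K $$ (i, j))) 0 0"
  have cons_sum: "(\<Sum>k<v. [:f k:]) = [:\<Sum>k<v. f k:]" for f :: "nat \<Rightarrow> real"
    by (induction v) auto
  have detT: "det ?T = 1"
    by (subst det_lower_triangular[of v]) (auto simp: prod_list_diag_prod)
  have detU: "det ?U = 1"
    by (subst det_upper_triangular[of _ v]) (auto simp: prod_list_diag_prod)
  have detD: "det ?D = [:0, 1:]"
  proof -
    have "det ?D = (\<Prod>i<v. if i = 0 then [:0, 1:] else 1)"
      by (subst det_upper_triangular[of _ v]) (auto simp: prod_list_diag_prod mat_diag_def atLeast0LessThan)
    thus ?thesis using v by simp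
  qed
  (* adding all columns of xW - K to the first turns it into x w *)
  have PT: "?P w * ?T = ?H w * ?D" for w
  proof (rule eq_matI)
    fix i j assume "i < dim_row (?H w * ?D)" "j < dim_col (?H w * ?D)"
    hence ij: "i < v" "j < v" by (auto simp: mat_diag_def)
    let ?p = "\<lambda>k. (if i = k then [:0, w i:] else 0) - [:K $$ (i, k):]"
    have "(?P w * ?T) $$ (i, j) = (\<Sum>k<v. ?p k * (if k = j \<or> j = 0 then 1 else 0))"
      using ij by (auto simp: scalar_prod_def atLeast0LessThan intro!: sum.cong)
    also have "\<dots> = (if j = 0 then [:0, w i:] else ?p j)"
    proof (cases "j = 0")
      case True
      have "(\<Sum>k<v. ?p k) = (\<Sum>k<v. if i = k then [:0, w i:] else 0) - [:\<Sum>k<v. K $$ (i, k):]"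
        unfolding sum_subtractf cons_sum ..
      thus ?thesis using True ij row by simp
    next
      case False
      have "(\<Sum>k<v. ?p k * (if k = j \<or> j = 0 then 1 else 0)) = (\<Sum>k<v. if k = j then ?p k else 0)"
        by (rule sum.cong) (use False in auto)
      thus ?thesis using False ij by simp
    qed
    also have "\<dots> = (?H w * ?D) $$ (i, j)"
      using ij by (subst mat_diag_mult_right[of _ v]) auto
    finally show "(?P w * ?T) $$ (i, j) = (?H w * ?D) $$ (i, j)" .
  qed (auto simp: mat_diag_def)
  have PH: "det (?P w) = [:0, 1:] * det (?H w)" for w
    using arg_cong[OF PT, of det w] detT detD
    by (subst (asm) (1 2) det_mult[of _ v]) (auto simp: mult.commute)
  have H0: "poly (det (?H w)) 0 = det (?E w)" for w
    by (rule poly_det_cong[of _ v]) auto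
  have detE: "det (?E w) = ?c" if w: "(\<Sum>i<v. w i) = 1" for w
  proof -
    (* adding all rows to the first turns it into a unit vector *)
    have UH: "?U * ?E w = mat v v (\<lambda>(i, j). if i = 0 then if j = 0 then 1 else 0
        else if j = 0 then w i else - K $$ (i, j))" (is "_ = ?G")
    proof (rule eq_matI)
      fix i j assume "i < dim_row ?G" "j < dim_col ?G"
      hence ij: "i < v" "j < v" by auto
      let ?q = "\<lambda>k. if j = 0 then w k else - K $$ (k, j)"
      have "(?U * ?E w) $$ (i, j) = (\<Sum>k<v. (if i = k \<or> i = 0 then 1 else 0) * ?q k)"
        using ij by (auto simp: scalar_prod_def atLeast0LessThan intro!: sum.cong)
      also have "\<dots> = ?G $$ (i, j)"
      proof (cases "i = 0")
        case True
        thus ?thesis using ij w col by (cases "j = 0") (simp_all add: sum_negf)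
      next
        case False
        have "(\<Sum>k<v. (if i = k \<or> i = 0 then 1 else 0) * ?q k) = (\<Sum>k<v. if i = k then ?q k else 0)"
          by (rule sum.cong) (use False in auto)
        thus ?thesis using False ij by simp
      qed
      finally show "(?U * ?E w) $$ (i, j) = ?G $$ (i, j)" .
    qed auto
    have "det (?E w) = det ?G" unfolding UH[symmetric] using detU
      by (subst det_mult[of _ v]) auto
    also have "\<dots> = (\<Sum>j<v. ?G $$ (0, j) * cofactor ?G 0 j)"
      by (rule laplace_expansion_row) (use v in auto)
    also have "\<dots> = (\<Sum>j<v. if j = 0 then cofactor ?G 0 j else 0)"
      by (rule sum.cong) (use v in auto)
    also have "\<dots> = cofactor ?G 0 0" using v by simp
    \<comment> \<open>Below row 0, w occurs only in column 0 of \<open>?G\<close>, so the minor no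
      longer depends on w.\<close>
    also have "mat_delete ?G 0 0 = mat_delete (mat v v (\<lambda>(i, j). - K $$ (i, j))) 0 0"
      by (rule eq_matI) (auto simp: mat_delete_def)
    hence "cofactor ?G 0 0 = ?c" by (simp add: cofactor_def)
    finally show ?thesis .
  qed
  show ?thesis
  proof (intro exI[of _ ?c] allI impI)
    fix w :: "nat \<Rightarrow> real" assume "(\<Sum>i<v. w i) = 1"
    thus "\<exists>h. poly h 0 = ?c \<and> det (?P w) = [:0, 1:] * h"
      using H0[of w] detE[of w] by (intro exI[of _ "det (?H w)"] conjI PH) (rule trans)
  qed
qed

section \<open>Maximal product of the weights\<close>

text \<open>Multiply the bounds t \<le> exp (t - 1) at t = v w_i: the exponents sum to v - v = 0, so
  the product of the v w_i is at most 1.\<close>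

lemma prod_le_uniform:
  fixes w :: "nat \<Rightarrow> real"
  assumes "\<And>i. i < v \<Longrightarrow> 0 \<le> w i" and "(\<Sum>i<v. w i) = 1"
  shows "(\<Prod>i<v. w i) \<le> (1 / real v) ^ v"
proof -
  have v: "v > 0" using assms(2) by (cases v) auto
  have "(\<Prod>i<v. real v * w i) \<le> (\<Prod>i<v. exp (real v * w i - 1))"
    using assms(1) exp_ge_add_one_self
    by (intro prod_mono) (smt (verit) lessThan_iff mult_nonneg_nonneg of_nat_0_le_iff)
  also have "\<dots> = exp (\<Sum>i<v. real v * w i - 1)" by (simp add: exp_sum)
  also have "(\<Sum>i<v. real v * w i - 1) = 0"
    using assms(2) by (simp add: sum_subtractf flip: sum_distrib_left)
  finally show ?thesis using v by (simp add: prod.distrib power_one_over field_simps)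
qed

section \<open>Invariance of the criterion times the product of the weights\<close>

text \<open>Positive weights make \<open>mat_inverse\<close> return a value, so \<open>the\<close>
  is applied to a \<open>Some\<close>; uniqueness of inverses identifies that value with the
  diagonal matrix of reciprocals.\<close>

lemma V_matrix_eq:
  assumes w: "feasible_design v w"
  shows "V_matrix Q w = transpose_mat Q * mat_diag v (\<lambda>i. 1 / w $ i) * Q"
proof -
  let ?M = "mat_diag v (\<lambda>i. w $ i)" and ?N = "mat_diag v (\<lambda>i. 1 / w $ i)"
  have dim: "dim_vec w = v" and pos: "\<And>i. i < v \<Longrightarrow> 0 < w $ i"
    using w unfolding feasible_design_def is_design_def by auto
  have MN: "?M * ?N = 1\<^sub>m v" "?N * ?M = 1\<^sub>m v"
  proof -
    have "mat_diag v (\<lambda>i. w $ i * (1 / w $ i)) = mat_diag v (\<lambda>i. 1)"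
      unfolding mat_diag_def by (rule cong_mat) (auto dest!: pos)
    thus "?M * ?N = 1\<^sub>m v" "?N * ?M = 1\<^sub>m v" by (simp_all add: mult.commute)
  qed
  hence "?M \<in> Units (ring_mat TYPE(real) v ())"
    unfolding Units_def by (auto simp: ring_mat_def intro!: bexI[of _ ?N])
  then obtain N where N: "mat_inverse ?M = Some N"
    using mat_inverse(1)[of ?M v "()"] by (cases "mat_inverse ?M") auto
  from mat_inverse(2)[OF _ this, of v] have "N * ?M = 1\<^sub>m v" "N \<in> carrier_mat v v" by auto
  hence "N = N * (?M * ?N)" unfolding MN by simp
  also have "\<dots> = (N * ?M) * ?N"
    by (rule assoc_mult_mat[symmetric, OF \<open>N \<in> carrier_mat v v\<close> mat_diag_dim mat_diag_dim])
  also have "\<dots> = ?N" unfolding \<open>N * ?M = 1\<^sub>m v\<close> by (rule left_mult_one_mat[OF mat_diag_dim])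
  finally have "N = ?N" .
  thus ?thesis unfolding V_matrix_def moment_matrix_def dim N by simp
qed

text \<open>Minimizing the criterion thereby becomes maximizing the product of the weights. The rank
  assumption makes the criterion a product of v - 1 eigenvalues, matching the roots of h.
  Nonnegativity is recorded for the final comparison.\<close>

lemma Psi0_mult_prod_const:
  assumes v: "v \<ge> 1" and s: "s \<ge> v - 1"
    and Q: "contrast_matrix v s Q" and rank: "mat_rank Q = v - 1"
  shows "\<exists>c. \<forall>w. feasible_design v w \<longrightarrow> 0 \<le> Psi0 Q w \<and> Psi0 Q w * (\<Prod>i<v. w $ i) = c"
proof -
  let ?K = "Q * transpose_mat Q"
  have Qc: "Q \<in> carrier_mat v s" and Q1: "transpose_mat Q *\<^sub>v ones_vec v = 0\<^sub>v s"
    using Q unfolding contrast_matrix_def by auto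
  have colsum: "(\<Sum>i<v. Q $$ (i, j)) = 0" if "j < s" for j
    using arg_cong[OF Q1, of "\<lambda>x. x $ j"] that Qc
    by (simp add: ones_vec_def scalar_prod_def atLeast0LessThan)
  have Kij: "?K $$ (i, j) = (\<Sum>l<s. Q $$ (i, l) * Q $$ (j, l))" if "i < v" "j < v" for i j
    using that Qc by (simp add: scalar_prod_def atLeast0LessThan)
  have row: "(\<Sum>j<v. ?K $$ (i, j)) = 0" if i: "i < v" for i
  proof -
    have "(\<Sum>j<v. ?K $$ (i, j)) = (\<Sum>j<v. \<Sum>l<s. Q $$ (i, l) * Q $$ (j, l))"
      by (rule sum.cong) (use i Kij in auto)
    also have "\<dots> = 0" by (subst sum.swap) (simp add: colsum flip: sum_distrib_left)
    finally show ?thesis .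
  qed
  have "?K $$ (i, j) = ?K $$ (j, i)" if "i < v" "j < v" for i j
    using that by (simp only: Kij mult.commute)
  hence col: "(\<Sum>i<v. ?K $$ (i, j)) = 0" if "j < v" for j
    using row[OF that] that by (metis (no_types, lifting) lessThan_iff sum.cong)
  obtain c where c: "\<And>w. (\<Sum>i<v. w i) = 1 \<Longrightarrow> \<exists>h. poly h 0 = c \<and>
    det (mat v v (\<lambda>(i, j). (if i = j then [:0, w i:] else 0) - [:?K $$ (i, j):])) = [:0, 1:] * h"
    using det_diag_minus_centered[of ?K v, OF _ v row col] Qc by auto
  have "0 \<le> Psi0 Q w \<and> Psi0 Q w * (\<Prod>i<v. w $ i) = (-1) ^ (v - 1) * c"
    if w: "feasible_design v w" for w
  proof -
    let ?D = "mat_diag v (\<lambda>i. 1 / w $ i)"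
    let ?V = "transpose_mat Q * ?D * Q"
    \<comment> \<open>This is K W^{-1}, bracketed as the reversal of the product (Q^T W^{-1}) Q so
      that \<open>char_poly_mult_commute\<close> applies.\<close>
    let ?B = "Q * (transpose_mat Q * ?D)"
    define p where "p = (\<Prod>i<v. w $ i)"
    have pos: "\<And>i. i < v \<Longrightarrow> 0 < w $ i" and sum: "(\<Sum>i<v. w $ i) = 1"
      using w unfolding feasible_design_def is_design_def by auto
    have p: "p > 0" unfolding p_def using pos by (auto intro: prod_pos)
    have QD: "transpose_mat Q * ?D \<in> carrier_mat s v" using Qc by auto
    have Bc: "?B \<in> carrier_mat v v" using QD Qc by auto
    obtain h where h: "poly h 0 = c"
      "det (mat v v (\<lambda>(i, j). (if i = j then [:0, w $ i:] else 0) - [:?K $$ (i, j):])) = [:0, 1:] * h"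
      using c[of "\<lambda>i. w $ i", OF sum] by blast
    have B: "?B = mat v v (\<lambda>(i, j). ?K $$ (i, j) / w $ j)"
    proof -
      have "?B = ?K * ?D" using Qc by (intro assoc_mult_mat[symmetric, OF Qc _ mat_diag_dim]) auto
      thus ?thesis using Qc by (subst (asm) mat_diag_mult_right[of _ v]) auto
    qed
    \<comment> \<open>Multiplying by W on the right clears the denominators: (x I - K W^{-1}) W = x
      W - K.\<close>
    have "char_poly_matrix ?B * mat_diag v (\<lambda>i. [:w $ i:]) =
      mat v v (\<lambda>(i, j). (if i = j then [:0, w $ i:] else 0) - [:?K $$ (i, j):])"
      using pos by (subst mat_diag_mult_right[of _ v v])
        (use Bc in \<open>simp; fail\<close>, auto simp: char_poly_matrix_def B intro!: eq_matI dest!: pos)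
    moreover have "det (mat_diag v (\<lambda>i. [:w $ i:])) = [:p:]"
    proof -
      have "det (mat_diag v (\<lambda>i. [:w $ i:])) = (\<Prod>i<v. [:w $ i:])"
        by (subst det_upper_triangular[of _ v]) (auto simp: prod_list_diag_prod mat_diag_def atLeast0LessThan)
      also have "\<dots> = [:p:]" unfolding p_def by (induction v) auto
      finally show ?thesis .
    qed
    moreover have "det (char_poly_matrix ?B * mat_diag v (\<lambda>i. [:w $ i:])) =
      char_poly ?B * det (mat_diag v (\<lambda>i. [:w $ i:]))"
      unfolding char_poly_def by (rule det_mult[OF char_poly_matrix_closed[OF Bc]]) simp
    ultimately have B_eq: "char_poly ?B * [:p:] = [:0, 1:] * h"
      using h(2) by (simp only:)
    have "[:0, 1:] ^ v * (char_poly ?V * [:p:]) = [:0, 1:] ^ s * ([:0, 1:] * h)"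
      unfolding mult.assoc[symmetric] char_poly_mult_commute[OF QD Qc]
      unfolding mult.assoc B_eq ..
    \<comment> \<open>The x in front of h joins x^s. The truncated difference s - (v - 1) is exact
      because s \<ge> v - 1, and it counts the zero eigenvalues to be split off.\<close>
    also have "\<dots> = [:0, 1:] ^ v * ([:0, 1:] ^ (s - (v - 1)) * h)"
    proof -
      have "[:0, 1:] ^ s * ([:0, 1:] * h) = [:0, 1:] ^ Suc s * h"
        by (simp only: power_Suc2 mult.assoc)
      also have "Suc s = v + (s - (v - 1))" using v s by simp
      finally show ?thesis by (simp only: power_add mult.assoc)
    qed
    finally have "char_poly ?V * [:p:] = [:0, 1:] ^ (s - (v - 1)) * h"
      by (simp only: mult_cancel_left) simp
    hence "Polynomial.smult (1 / p) ([:p:] * char_poly ?V) = Polynomial.smult (1 / p) ([:0, 1:] ^ (s - (v - 1)) * h)"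
      by (simp only: mult.commute)
    hence fac: "char_poly ?V = [:0, 1:] ^ (s - (v - 1)) * Polynomial.smult (1 / p) h"
      using p by simp
    obtain R where R: "char_poly ?V = (\<Prod>b\<in>#R. [:- b, 1:])" "size R = s" "\<forall>b\<in>#R. 0 \<le> b"
      using char_poly_psd_splits[OF Qc, of "\<lambda>i. 1 / w $ i"] pos by (metis less_imp_le zero_le_divide_1_iff)
    have "size R = (s - (v - 1)) + (v - 1)" using R(2) s by simp
    \<comment> \<open>With g = h / p the product of eigenvalues is (-1)^(v - 1) h(0) / p, and h(0) =
      c is the same for all designs.\<close>
    note eig = prod_largest_eigvals[OF R(1,3) this fac]
    show ?thesis using eig p h(1)
      unfolding Psi0_def V_matrix_eq[OF w] rank p_def[symmetric] by simp
  qed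
  thus ?thesis by blast
qed

section \<open>Optimality of the uniform design\<close>

lemma feasible_uniform_design:
  assumes "v \<ge> 1"
  shows "feasible_design v (uniform_design v)"
  using assms unfolding feasible_design_def is_design_def uniform_design_def ones_vec_def by auto

theorem theorem2:
  fixes v s :: nat and Q :: "real mat"
  assumes "v \<ge> 1"
    and "s \<ge> v - 1"
    and "contrast_matrix v s Q"
    and "mat_rank Q = v - 1"
  shows "Psi0_optimal v Q (uniform_design v)"
proof -
  let ?u = "uniform_design v"
  obtain c where c: "\<And>w. feasible_design v w \<Longrightarrow> 0 \<le> Psi0 Q w \<and> Psi0 Q w * (\<Prod>i<v. w $ i) = c"
    using Psi0_mult_prod_const[OF assms] by auto
  have u: "feasible_design v ?u" using assms(1) by (rule feasible_uniform_design)
  have pu: "(\<Prod>i<v. ?u $ i) = (1 / real v) ^ v" by (simp add: uniform_design_def ones_vec_def)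
  have "Psi0 Q ?u \<le> Psi0 Q w" if w: "feasible_design v w" for w
  proof -
    have "Psi0 Q ?u * (\<Prod>i<v. ?u $ i) = Psi0 Q w * (\<Prod>i<v. w $ i)" using c u w by metis
    \<comment> \<open>Since \<open>Psi0 Q w\<close> is nonnegative, enlarging the product of the
      weights to its maximum keeps the inequality; the positive factor (1/v)^v then cancels.\<close>
    also have "\<dots> \<le> Psi0 Q w * (\<Prod>i<v. ?u $ i)"
      unfolding pu using w c[OF w]
      by (intro mult_left_mono prod_le_uniform) (auto simp: feasible_design_def is_design_def)
    finally show ?thesis unfolding pu using assms(1) by (simp add: mult_le_cancel_right)
  qed
  thus ?thesis unfolding Psi0_optimal_def using u by blast
qed

end
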